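(* Let $V\subset\mathbb{R}^d$ and let $\phi:V\to[0,\infty)$ be an arbitrary non-negative real valued function which is finite on some non-empty neighborhood of the origin contained in $V$. Let $\xi=(\xi(1),\dots,\xi(d))$ be a centered random vector such that $\|\xi\|B(\phi)\le1$, i.e. $$\max_{\epsilon\in\{-1,1\}^d}\mathbf{E}\exp\Big(\sum_{j=1}^d\epsilon(j)\lambda(j)\xi(j)\Big)\le e^{\phi(\lambda)},\qquad\lambda\in V.$$ Then for every vector $x\in\mathbb{R}^d$ with non-negative coordinates, $$U(\xi,x)\le\exp\left(-\phi^*(x)\right).$$
   Context: The tail function of a random vector $\xi$ at $x$ with non-negative coordinates is $U(\xi,x)=\max_{\epsilon\in\{-1,1\}^d}\mathbf{P}\big(\bigcap_{j=1}^d\{\epsilon(j)\xi(j)>x(j)\}\big)$. The Young–Fenchel transform is $\phi^*(x)=\sup_{\lambda\in V}\left[(\lambda,x)-\phi(\lambda)\right]$, with $(\cdot,\cdot)$ the standard scalar product. "Centered" means mean zero. *)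

theory Defs
  imports "HOL-Probability.Probability"
begin

definition sign_vectors :: "(real ^ 'd) set" where
  "sign_vectors = {\<epsilon>. \<forall>j. \<epsilon> $ j \<in> {-1, 1}}"

text \<open>The maxima below range over a finite non-empty set, so \<^const>\<open>Max\<close> is meaningful.\<close>

lemma finite_sign_vectors: "finite (sign_vectors :: (real ^ 'd) set)"
proof -
  have "(sign_vectors :: (real ^ 'd) set) \<subseteq> vec_lambda ` (UNIV \<rightarrow>\<^sub>E {-1, 1 :: real})"
  proof
    fix e :: "real ^ 'd"
    assume "e \<in> sign_vectors"
    then have "(\<lambda>j. e $ j) \<in> UNIV \<rightarrow>\<^sub>E {-1, 1}"
      by (auto simp: sign_vectors_def)
    moreover have "e = vec_lambda (\<lambda>j. e $ j)"
      by simp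
    ultimately show "e \<in> vec_lambda ` (UNIV \<rightarrow>\<^sub>E {-1, 1 :: real})"
      by blast
  qed
  then show ?thesis
    by (rule finite_subset) (auto intro!: finite_imageI finite_PiE)
qed

lemma sign_vectors_nonempty: "sign_vectors \<noteq> {}"
proof -
  have "(\<chi> j. 1) \<in> sign_vectors"
    by (simp add: sign_vectors_def)
  then show ?thesis
    by blast
qed

definition tail_function :: "'a measure \<Rightarrow> ('a \<Rightarrow> real ^ 'd) \<Rightarrow> real ^ 'd \<Rightarrow> real" where
  "tail_function M \<xi> x =
     Max ((\<lambda>\<epsilon>. measure M {\<omega> \<in> space M. \<forall>j. \<epsilon> $ j * \<xi> \<omega> $ j > x $ j}) ` sign_vectors)"

definition centered :: "'a measure \<Rightarrow> ('a \<Rightarrow> real ^ 'd) \<Rightarrow> bool" where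
  "centered M \<xi> \<longleftrightarrow> integrable M \<xi> \<and> (LINT \<omega>|M. \<xi> \<omega>) = 0"

text \<open>The condition that the \<open>B(\<phi>)\<close> norm of \<open>\<xi>\<close> is at most 1. The expectations are
  taken in \<open>[0,\<infinity>]\<close>, so the bound includes their finiteness.\<close>

definition B_norm_le_1 ::
  "'a measure \<Rightarrow> (real ^ 'd) set \<Rightarrow> (real ^ 'd \<Rightarrow> real) \<Rightarrow> ('a \<Rightarrow> real ^ 'd) \<Rightarrow> bool" where
  "B_norm_le_1 M V \<phi> \<xi> \<longleftrightarrow>
     (\<forall>\<theta>\<in>V.
        Max ((\<lambda>\<epsilon>. \<integral>\<^sup>+ \<omega>. ennreal (exp (\<Sum>j\<in>UNIV. \<epsilon> $ j * \<theta> $ j * \<xi> \<omega> $ j)) \<partial>M) ` sign_vectors)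
          \<le> ennreal (exp (\<phi> \<theta>)))"

text \<open>The supremum may be \<open>\<infinity>\<close>, hence the extended real values and the
  corresponding extension of the exponential function.\<close>

definition young_fenchel ::
  "(real ^ 'd) set \<Rightarrow> (real ^ 'd \<Rightarrow> real) \<Rightarrow> real ^ 'd \<Rightarrow> ereal" where
  "young_fenchel V \<phi> x = (SUP \<theta>\<in>V. ereal (\<theta> \<bullet> x - \<phi> \<theta>))"

definition exp_ereal :: "ereal \<Rightarrow> ereal" where
  "exp_ereal y =
     (if y = \<infinity> then \<infinity> else if y = -\<infinity> then 0 else ereal (exp (real_of_ereal y)))"

end

theory Submission
  imports Defs
begin

text \<open>This is Chernoff's bound. The hypothesis at \<open>\<theta>\<close> ranges over all sign vectors, so it depends
  only on the absolute values of the coordinates of \<open>\<theta>\<close>: for a given \<open>\<epsilon>\<close>, the sign vector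
  \<open>\<epsilon>(j) sgn \<theta>(j)\<close> turns the exponent into \<open>\<Sum>\<^sub>j \<bar>\<theta>(j)\<bar> \<epsilon>(j) \<xi>(j)\<close>, which on the event
  \<open>\<epsilon>(j) \<xi>(j) > x(j)\<close> is at least \<open>\<Sum>\<^sub>j \<bar>\<theta>(j)\<bar> x(j) \<ge> (\<theta>, x)\<close> because \<open>x \<ge> 0\<close>. Hence \<open>V\<close> need not be
  symmetric or contained in the positive orthant.\<close>

lemma prob_orthant_le_exp:
  fixes \<xi> :: "'a \<Rightarrow> real ^ 'd"
  assumes "prob_space M"
    and meas: "\<xi> \<in> borel_measurable M"
    and norm: "B_norm_le_1 M V \<phi> \<xi>"
    and nonneg: "\<forall>j. 0 \<le> x $ j"
    and \<theta>: "\<theta> \<in> V"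
    and \<epsilon>: "\<epsilon> \<in> sign_vectors"
  shows "measure M {\<omega> \<in> space M. \<forall>j. \<epsilon> $ j * \<xi> \<omega> $ j > x $ j} \<le> exp (\<phi> \<theta> - \<theta> \<bullet> x)"
proof -
  interpret prob_space M by fact
  define \<delta> :: "real ^ 'd" where "\<delta> = (\<chi> j. if \<theta> $ j < 0 then - \<epsilon> $ j else \<epsilon> $ j)"
  have \<delta>: "\<delta> \<in> sign_vectors"
    using \<epsilon> by (auto simp: sign_vectors_def \<delta>_def)
  have \<delta>_mult: "\<delta> $ j * \<theta> $ j * t = \<bar>\<theta> $ j\<bar> * (\<epsilon> $ j * t)" for j t
    by (simp add: \<delta>_def)
  let ?A = "{\<omega> \<in> space M. \<forall>j. \<epsilon> $ j * \<xi> \<omega> $ j > x $ j}"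
  let ?f = "\<lambda>\<omega>. exp (\<Sum>j\<in>UNIV. \<delta> $ j * \<theta> $ j * \<xi> \<omega> $ j)"
  have comp[measurable]: "(\<lambda>\<omega>. \<xi> \<omega> $ j) \<in> borel_measurable M" for j
    using borel_measurable_continuous_on[OF _ meas, of "\<lambda>v. v $ j"]
    by (simp add: continuous_on_component)
  have A[measurable]: "?A \<in> sets M"
    by measurable
  have lower: "exp (\<theta> \<bullet> x) \<le> ?f \<omega>" if "\<omega> \<in> ?A" for \<omega>
  proof -
    have "\<theta> $ j * x $ j \<le> \<delta> $ j * \<theta> $ j * \<xi> \<omega> $ j" for j
    proof -
      have "\<theta> $ j * x $ j \<le> \<bar>\<theta> $ j\<bar> * x $ j"
        using nonneg by (intro mult_right_mono) auto
      also have "\<dots> \<le> \<bar>\<theta> $ j\<bar> * (\<epsilon> $ j * \<xi> \<omega> $ j)"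
        using that by (intro mult_left_mono) (auto intro: less_imp_le)
      finally show ?thesis
        by (simp only: \<delta>_mult)
    qed
    then show ?thesis
      by (simp add: inner_vec_def sum_mono)
  qed
  \<comment> \<open>Markov's inequality for \<open>?f\<close>, carried out in \<open>ennreal\<close>
    so that integrability of \<open>?f\<close> need not be shown first.\<close>
  have "ennreal (exp (\<theta> \<bullet> x) * prob ?A) = (\<integral>\<^sup>+\<omega>. ennreal (exp (\<theta> \<bullet> x)) * indicator ?A \<omega> \<partial>M)"
    by (simp add: nn_integral_cmult_indicator emeasure_eq_measure ennreal_mult)
  also have "\<dots> \<le> (\<integral>\<^sup>+\<omega>. ennreal (?f \<omega>) \<partial>M)"
    using lower by (intro nn_integral_mono) (auto simp: indicator_def intro!: ennreal_leI)
  also have "\<dots> \<le> Max ((\<lambda>\<epsilon>. \<integral>\<^sup>+ \<omega>. ennreal (exp (\<Sum>j\<in>UNIV. \<epsilon> $ j * \<theta> $ j * \<xi> \<omega> $ j)) \<partial>M)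
      ` sign_vectors)"
    using \<delta> by (intro Max_ge finite_imageI finite_sign_vectors imageI)
  also have "\<dots> \<le> ennreal (exp (\<phi> \<theta>))"
    using norm \<theta> by (simp add: B_norm_le_1_def)
  finally have "exp (\<theta> \<bullet> x) * prob ?A \<le> exp (\<phi> \<theta>)"
    by simp
  then show ?thesis
    by (simp add: exp_diff field_simps)
qed

text \<open>Optimisation over \<theta>: taking logarithms makes \<open>- ln p\<close> an upper bound
  of every \<theta> \<bullet> x - \<phi> \<theta>, hence of their supremum.\<close>

lemma le_exp_ereal_neg_young_fenchel:
  assumes bound: "\<And>\<theta>. \<theta> \<in> V \<Longrightarrow> p \<le> exp (\<phi> \<theta> - \<theta> \<bullet> x)"
  shows "ereal p \<le> exp_ereal (- young_fenchel V \<phi> x)"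
proof (cases "p \<le> 0")
  \<comment> \<open>A tail probability may vanish, and then there is no logarithm to take.\<close>
  case True
  then have "ereal p \<le> 0"
    by simp
  also have "0 \<le> exp_ereal (- young_fenchel V \<phi> x)"
    by (simp add: exp_ereal_def)
  finally show ?thesis .
next
  case False
  have "\<theta> \<bullet> x - \<phi> \<theta> \<le> - ln p" if "\<theta> \<in> V" for \<theta>
    using ln_mono[OF bound[OF that]] False by simp
  then have "young_fenchel V \<phi> x \<le> ereal (- ln p)"
    unfolding young_fenchel_def by (auto intro!: SUP_least)
  then show ?thesis
  proof (cases "young_fenchel V \<phi> x")
    case (real y)
    with \<open>young_fenchel V \<phi> x \<le> ereal (- ln p)\<close> have "ln p \<le> - y"
      by simp
    then have "p \<le> exp (- y)"
      using False by (metis exp_le_cancel_iff exp_ln not_le)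
    then show ?thesis
      by (simp add: real exp_ereal_def)
  \<comment> \<open>The value \<infinity> contradicts the finite bound \<open>- ln p\<close>; the
    value -\<infinity> makes the right-hand side \<infinity>.\<close>
  qed (auto simp: exp_ereal_def)
qed

theorem proposition6p1:
  fixes M :: "'a measure"
    and V :: "(real ^ 'd) set"
    and \<phi> :: "real ^ 'd \<Rightarrow> real"
    and \<xi> :: "'a \<Rightarrow> real ^ 'd"
    and x :: "real ^ 'd"
  assumes "prob_space M"
    and "\<exists>N. open N \<and> 0 \<in> N \<and> N \<subseteq> V"
    and "\<forall>\<theta>\<in>V. 0 \<le> \<phi> \<theta>"
    and "\<xi> \<in> borel_measurable M"
    and "centered M \<xi>"
    and "B_norm_le_1 M V \<phi> \<xi>"
    and "\<forall>j. 0 \<le> x $ j"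
  shows "ereal (tail_function M \<xi> x) \<le> exp_ereal (- young_fenchel V \<phi> x)"
proof (rule le_exp_ereal_neg_young_fenchel)
  fix \<theta> assume "\<theta> \<in> V"
  \<comment> \<open>The bound for a single orthant does not depend on the sign vector, so it passes
    to the maximum over the finite set.\<close>
  with assms show "tail_function M \<xi> x \<le> exp (\<phi> \<theta> - \<theta> \<bullet> x)"
    by (auto simp: tail_function_def finite_sign_vectors sign_vectors_nonempty
        intro: prob_orthant_le_exp)
qed

end
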